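(* Let $m$ be a positive integer, let $A>0$, and let $f(t)$ be the characteristic function of a non-degenerate $m$-divisible symmetric probability distribution on $\mathbb{R}$ with compact support contained in $[-A,A]$ and with standard deviation $\sigma$. Then $$\cos^m\!\left(\frac{\sigma t}{\sqrt m}\right)\le f(t)$$ for all real $t$ with $|t|\le \min\left(\dfrac{4.49\,m}{A},\ \dfrac{\pi\sqrt m}{2\sigma}\right)$.
   Context: A characteristic function $f$ (or the corresponding distribution) is called $m$-divisible, for a positive integer $m$, if $f^{1/m}$ is also a characteristic function, i.e. there is a characteristic function $g$ of a probability distribution on $\mathbb{R}$ with $g^m=f$. A distribution on $\mathbb{R}$ is symmetric if it is invariant under $x\mapsto -x$; equivalently, its characteristic function is real-valued and even. Here $4.49$ is the exact decimal number. *)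

theory Defs
  imports "HOL-Probability.Probability"
begin

definition is_char_fun :: "(real \<Rightarrow> complex) \<Rightarrow> bool" where
  "is_char_fun f \<longleftrightarrow> (\<exists>M. real_distribution M \<and> f = char M)"

text \<open>The complex root \<open>f powr (1/m)\<close> is multivalued, so an \<open>m\<close>-th root is rendered as any
  characteristic function \<open>g\<close> whose pointwise \<open>m\<close>-th power is \<open>f\<close>.\<close>
definition divisible_char_fun :: "nat \<Rightarrow> (real \<Rightarrow> complex) \<Rightarrow> bool" where
  "divisible_char_fun m f \<longleftrightarrow>
     is_char_fun f \<and> (\<exists>g. is_char_fun g \<and> (\<forall>t. g t ^ m = f t))"

definition symmetric_distribution :: "real measure \<Rightarrow> bool" where
  "symmetric_distribution M \<longleftrightarrow> distr M borel uminus = M"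

definition degenerate_distribution :: "real measure \<Rightarrow> bool" where
  "degenerate_distribution M \<longleftrightarrow> (\<exists>c. M = return borel c)"

definition measure_support :: "real measure \<Rightarrow> real set" where
  "measure_support M = {x. \<forall>U. open U \<and> x \<in> U \<longrightarrow> emeasure M U > 0}"

text \<open>Only meaningful when \<open>x\<^sup>2\<close> is integrable (otherwise the integrals default to \<open>0\<close>); this is the
  case for every distribution of bounded support.\<close>
definition std_dev :: "real measure \<Rightarrow> real" where
  "std_dev M = sqrt (prob_space.variance M (\<lambda>x. x))"

end

(* If g ^ m = f and g is the characteristic function of N, then M is the law of a sum of m independent
   N-distributed variables, so N lives on [-A/m, A/m], has mean 0 and variance \<sigma>\<^sup>2 / m. Since
   cos (sqrt u) is convex on [0, 4.49\<^sup>2], Jensen's inequality gives Re (g t) \<ge> cos (\<sigma> t / sqrt m) \<ge> 0.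
   As g has no zeros in the interior of the range of t, and g ^ m is real there, continuity from
   g 0 = 1 keeps g itself real, and the inequality can be raised to the m-th power. *)
theory Submission
  imports Defs
begin

section \<open>Real analysis: convexity of \<open>cos (sqrt u)\<close> up to
  \<open>u = 4.49 ^ 2\<close>\<close>

lemma sin_ge_cubic:
  fixes x :: real
  assumes "0 \<le> x"
  shows "x - x ^ 3 / 6 \<le> sin x"
proof -
  have "(\<Sum>m<3. sin_coeff m * x ^ m) = x"
    by (simp add: numeral_3_eq_3 sin_coeff_Suc cos_coeff_Suc)
  then have "\<bar>sin x - x\<bar> \<le> x ^ 3 / 6"
    using Maclaurin_sin_bound[of x 3] assms by (simp add: fact_numeral)
  then show ?thesis unfolding abs_le_iff by simp
qed

text \<open>The function \<open>h\<close> has derivative \<open>- (x * sin x)\<close>, so it falls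
  from \<open>h 0 = 0\<close> up to \<open>pi\<close> and rises from there to 4.49. On the rising
  stretch the sign at a single point to the right suffices.\<close>

lemma x_cos_le_sin:
  fixes x :: real
  assumes "0 \<le> x" "x \<le> 4.49"
  shows "x * cos x \<le> sin x"
proof -
  define h where "h = (\<lambda>x::real. x * cos x - sin x)"
  have deriv: "(h has_real_derivative - (x * sin x)) (at x)" for x
    unfolding h_def by (auto intro!: derivative_eq_intros)
  have "h x \<le> 0"
  proof (cases "x \<le> pi")
    case True
    have "h x \<le> h 0"
    proof (rule DERIV_nonpos_imp_nonincreasing[OF assms(1)])
      fix y assume "0 \<le> y" "y \<le> x"
      then show "\<exists>l. (h has_real_derivative l) (at y) \<and> l \<le> 0"
        using deriv[of y] True sin_ge_zero[of y] by (intro exI conjI) auto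
    qed
    then show ?thesis by (simp add: h_def)
  next
    case False
    \<comment> \<open>The point is about 4.4904, between 4.49 and the root 4.4934... of
      \<open>h\<close>. The shift by \<open>3/2 * pi\<close> turns its sine and cosine into those of
      the small angle 0.222.\<close>
    have "h x \<le> h (3/2 * pi - 0.222)"
    proof (rule DERIV_nonneg_imp_nondecreasing[where f = h])
      show "x \<le> 3/2 * pi - 0.222" using assms(2) pi_approx by simp
      fix y assume y: "x \<le> y" "y \<le> 3/2 * pi - 0.222"
      have "sin y = - sin (y - pi)" by (simp add: sin_diff)
      moreover have "0 \<le> sin (y - pi)"
        using y False by (intro sin_ge_zero) auto
      ultimately show "\<exists>l. (h has_real_derivative l) (at y) \<and> 0 \<le> l"
        using deriv[of y] False y by (intro exI conjI) (auto simp: mult_nonneg_nonpos)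
    qed
    also have "\<dots> \<le> 0"
    proof -
      have c: "cos (3/2 * pi - 0.222) = - sin 0.222" and s: "sin (3/2 * pi - 0.222) = - cos 0.222"
        unfolding cos_diff sin_diff cos_3over2_pi sin_3over2_pi by simp_all
      \<comment> \<open>The goal becomes
        \<open>cos 0.222 \<le> (3/2 * pi - 0.222) * sin 0.222\<close>. The bounds below give 0.976
        on the left and 4.48 * 0.22 = 0.9856 on the right; the cosine is bounded through the half
        angle 0.111.\<close>
      have sl: "sin (0.222::real) \<ge> 0.22" and "sin (0.111::real) \<ge> 0.11"
        using sin_ge_cubic[of "0.222"] sin_ge_cubic[of "0.111"] by (simp_all add: power3_eq_cube)
      then have "sin (0.111::real) ^ 2 \<ge> 0.11 ^ 2" by (intro power_mono) auto
      then have cu: "cos (0.222::real) \<le> 0.976"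
        using cos_double_sin[of "0.111::real"] by (simp add: power2_eq_square)
      have "4.48 * 0.22 \<le> (3/2 * pi - 0.222) * sin 0.222"
        using pi_approx sl by (intro mult_mono) auto
      with cu show ?thesis unfolding h_def c s by simp
    qed
    finally show ?thesis .
  qed
  then show ?thesis by (simp add: h_def)
qed

text \<open>The numerator of the derivative is the quantity from \<open>x_cos_le_sin\<close>. Since
  \<open>cos (sqrt u)\<close> has derivative \<open>- sin (sqrt u) / (2 * sqrt u)\<close>, this
  monotonicity is its convexity.\<close>

lemma sinc_antimono:
  fixes x y :: real
  assumes "0 < x" "x \<le> y" "y \<le> 4.49"
  shows "sin y / y \<le> sin x / x"
proof (rule DERIV_nonpos_imp_nonincreasing[OF assms(2)])
  fix z assume z: "x \<le> z" "z \<le> y"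
  have "((\<lambda>z. sin z / z) has_real_derivative (z * cos z - sin z) / z\<^sup>2) (at z)"
    using z assms by (auto intro!: derivative_eq_intros simp: power2_eq_square field_simps)
  moreover have "(z * cos z - sin z) / z\<^sup>2 \<le> 0"
    using x_cos_le_sin[of z] z assms by (intro divide_nonpos_nonneg) auto
  ultimately show "\<exists>l. ((\<lambda>z. sin z / z) has_real_derivative l) (at z) \<and> l \<le> 0" by blast
qed

text \<open>The left side is the tangent of \<open>cos (sqrt u)\<close> at
  \<open>u = s\<^sup>2\<close>, evaluated at \<open>u = x\<^sup>2\<close>. The even function
  \<open>h\<close> is smallest at \<open>s\<close> on \<open>[0, 4.49]\<close>, because its
  derivative changes sign there.\<close>

lemma cos_ge_tangent_in_square:
  fixes x s :: real
  assumes s: "0 < s" "s \<le> 4.49" and x: "\<bar>x\<bar> \<le> 4.49"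
  shows "cos s - sin s / (2 * s) * (x\<^sup>2 - s\<^sup>2) \<le> cos x"
proof -
  define h where "h = (\<lambda>x. cos x + sin s / (2 * s) * x\<^sup>2)"
  \<comment> \<open>At \<open>y = 0\<close> the quotient \<open>sin y / y\<close> defaults to 0,
    which is harmless because of the factor \<open>y\<close>.\<close>
  have deriv: "(h has_real_derivative y * (sin s / s - sin y / y)) (at y)" for y
    unfolding h_def using s by (auto intro!: derivative_eq_intros simp: field_simps power2_eq_square)
  have "h s \<le> h \<bar>x\<bar>"
  proof (cases "s \<le> \<bar>x\<bar>")
    case True
    then show ?thesis
    proof (rule DERIV_nonneg_imp_nondecreasing)
      fix y assume "s \<le> y" "y \<le> \<bar>x\<bar>"
      then show "\<exists>l. (h has_real_derivative l) (at y) \<and> 0 \<le> l"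
        using deriv[of y] sinc_antimono[of s y] s x by (intro exI conjI) auto
    qed
  next
    case False
    then have "\<bar>x\<bar> \<le> s" by simp
    then show ?thesis
    proof (rule DERIV_nonpos_imp_nonincreasing)
      fix y assume "\<bar>x\<bar> \<le> y" "y \<le> s"
      then show "\<exists>l. (h has_real_derivative l) (at y) \<and> l \<le> 0"
        using deriv[of y] sinc_antimono[of y s] s
        by (intro exI conjI) (auto simp: mult_le_0_iff)
    qed
  qed
  then show ?thesis by (simp add: h_def algebra_simps)
qed

section \<open>Support, moments and characteristic function of one distribution\<close>

context real_distribution
begin

lemma integrable_power_bounded:
  assumes "AE x in M. \<bar>x\<bar> \<le> B"
  shows "integrable M (\<lambda>x. x ^ k)"
  by (rule integrable_const_bound[where B = "B ^ k"])
    (use assms in \<open>auto elim!: eventually_mono intro!: power_mono simp: power_abs\<close>)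

lemma Re_char: "Re (char M t) = expectation (\<lambda>x. cos (t * x))"
proof -
  have "integrable M (\<lambda>x. iexp (t * x))" by (intro integrable_iexp) auto
  then have "Re (char M t) = expectation (\<lambda>x. Re (iexp (t * x)))"
    unfolding char_def by (rule integral_Re[symmetric])
  then show ?thesis by (simp add: Re_exp)
qed

text \<open>This is Jensen's inequality for \<open>u \<mapsto> cos (sqrt u)\<close>, which is convex on \<open>[0, 4.49\<^sup>2]\<close> because
  \<open>4.49\<close> lies below the first positive root \<open>4.4934\<dots>\<close> of \<open>tan x = x\<close>.\<close>
lemma cos_le_Re_char:
  assumes B: "AE x in M. \<bar>x\<bar> \<le> B" and t: "\<bar>t\<bar> * B \<le> 4.49"
    and s: "s\<^sup>2 = t\<^sup>2 * expectation (\<lambda>x. x\<^sup>2)" "\<bar>s\<bar> \<le> 4.49" "s \<noteq> 0"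
  shows "cos s \<le> Re (char M t)"
proof -
  define r where "r = \<bar>s\<bar>"
  have r: "0 < r" "r \<le> 4.49" "r\<^sup>2 = t\<^sup>2 * expectation (\<lambda>x. x\<^sup>2)" using s by (auto simp: r_def)
  note int2 = integrable_power_bounded[OF B, of 2]
  \<comment> \<open>The tangent is taken at \<open>r\<^sup>2\<close>, the mean of
    \<open>(t * x)\<^sup>2\<close>, so its linear term integrates to 0.\<close>
  have "cos r = expectation (\<lambda>x. cos r - sin r / (2 * r) * (t\<^sup>2 * x\<^sup>2 - r\<^sup>2))"
    using int2 r by (simp add: prob_space[unfolded space_eq_univ])
  also have "\<dots> \<le> expectation (\<lambda>x. cos (t * x))"
  proof (rule integral_mono_AE)
    show "integrable M (\<lambda>x. cos (t * x))"
      by (rule integrable_const_bound[where B = 1]) auto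
    show "AE x in M. cos r - sin r / (2 * r) * (t\<^sup>2 * x\<^sup>2 - r\<^sup>2) \<le> cos (t * x)"
      using B
    proof (eventually_elim)
      case (elim x)
      have "\<bar>t * x\<bar> \<le> \<bar>t\<bar> * B" using elim by (simp add: abs_mult mult_left_mono)
      with t have "\<bar>t * x\<bar> \<le> 4.49" by linarith
      from cos_ge_tangent_in_square[OF r(1,2) this] show ?case by (simp add: power_mult_distrib)
    qed
  qed (use int2 in auto)
  finally show ?thesis by (simp add: Re_char r_def)
qed

text \<open>The complement of the support is a union of open null sets, and the Lindelof property
  reduces it to a countable one.\<close>

lemma AE_in_measure_support: "AE x in M. x \<in> measure_support M"
proof -
  define \<U> where "\<U> = {U. open U \<and> emeasure M U = 0}"
  obtain \<V> where \<V>: "\<V> \<subseteq> \<U>" "countable \<V>" "\<Union>\<V> = \<Union>\<U>"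
    using Lindelof[of \<U>] unfolding \<U>_def by blast
  have "(\<Union>V\<in>\<V>. V) \<in> null_sets M"
    using \<V> by (intro null_sets_UN') (auto simp: \<U>_def null_sets_def)
  then have "AE x in M. x \<notin> \<Union>\<V>" by (auto dest: AE_not_in)
  then show ?thesis
    by eventually_elim (auto simp: \<V>(3) \<U>_def measure_support_def zero_less_iff_neq_zero)
qed

lemma Im_char_symmetric:
  assumes "symmetric_distribution M"
  shows "Im (char M t) = 0"
proof -
  have "char M t = char (distr M borel uminus) t"
    using assms by (simp add: symmetric_distribution_def)
  also have "\<dots> = (CLINT x|M. cnj (iexp (t * x)))"
    by (simp add: char_def integral_distr exp_cnj)
  also have "\<dots> = cnj (char M t)" by (simp add: char_def)
  finally have "Im (char M t) = Im (cnj (char M t))" by (rule arg_cong)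
  then show ?thesis by simp
qed

lemma expectation_symmetric:
  assumes "symmetric_distribution M"
  shows "expectation (\<lambda>x. x) = 0"
proof -
  have "expectation (\<lambda>x. x) = integral\<^sup>L (distr M borel uminus) (\<lambda>x. x)"
    using assms by (simp add: symmetric_distribution_def)
  also have "\<dots> = - expectation (\<lambda>x. x)" by (subst integral_distr) auto
  finally show ?thesis by simp
qed

end

text \<open>The quotient \<open>g / \<bar>g\<bar>\<close> takes values in the finite set of \<open>2 m\<close>-th roots of unity.\<close>
lemma real_if_power_real_connected:
  fixes g :: "'a::topological_space \<Rightarrow> complex"
  assumes "connected S" "continuous_on S g" "m > 0"
    and nz: "\<And>t. t \<in> S \<Longrightarrow> g t \<noteq> 0" and re: "\<And>t. t \<in> S \<Longrightarrow> g t ^ m \<in> \<real>"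
    and "a \<in> S" "g a = 1" "t \<in> S"
  shows "g t \<in> \<real>"
proof -
  define h where "h = (\<lambda>t. g t / of_real (norm (g t)))"
  have cont: "continuous_on S h"
    unfolding h_def using assms by (intro continuous_intros) auto
  have root: "h t ^ (2 * m) = 1" if "t \<in> S" for t
  proof -
    obtain r where r: "g t ^ m = of_real r" using re[of t] \<open>t \<in> S\<close> by (auto elim: Reals_cases)
    have "norm (g t) ^ m = \<bar>r\<bar>" using arg_cong[OF r, of norm] by (simp add: norm_power)
    moreover have "r \<noteq> 0" using r nz[OF that] by auto
    ultimately have "h t ^ m = of_real (r / \<bar>r\<bar>)"
      by (simp add: h_def power_divide r flip: of_real_power)
    then have "(h t ^ m)\<^sup>2 = of_real ((r / \<bar>r\<bar>)\<^sup>2)" by (simp only: of_real_power)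
    also have "(r / \<bar>r\<bar>)\<^sup>2 = 1" using \<open>r \<noteq> 0\<close> by (simp add: power_divide)
    finally show ?thesis by (simp add: power_mult mult.commute)
  qed
  have "finite (h ` S)"
    by (rule finite_subset[OF _ finite_roots_unity[of "2 * m"]]) (use root assms in auto)
  then obtain c where "\<And>x. x \<in> S \<Longrightarrow> h x = c"
    using continuous_finite_range_constant[OF assms(1) cont] by (auto simp: constant_on_def)
  \<comment> \<open>As \<open>h a = 1\<close>, every value of \<open>g\<close> on \<open>S\<close>
    equals its own norm.\<close>
  then have "h t = h a" using assms by metis
  then have "g t = of_real (norm (g t))" using assms nz by (simp add: h_def field_simps)
  then show ?thesis by (metis Reals_of_real)
qed

section \<open>Sums of \<open>m\<close> independent copies of the root distribution\<close>

lemma indep_vars_coordinates: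
  assumes "\<And>i. i \<in> I \<Longrightarrow> prob_space (M i)" "I \<noteq> {}"
  shows "prob_space.indep_vars (PiM I M) M (\<lambda>i \<omega>. \<omega> i) I"
proof -
  interpret P: prob_space "PiM I M" by (rule prob_space_PiM) (use assms in auto)
  have "distr (PiM I M) (PiM I M) (\<lambda>x. restrict x I) = distr (PiM I M) (PiM I M) (\<lambda>x. x)"
    by (intro distr_cong) (auto simp: space_PiM PiE_restrict)
  also have "\<dots> = PiM I (\<lambda>i. distr (PiM I M) (M i) (\<lambda>\<omega>. \<omega> i))"
    by (auto simp: distr_PiM_component assms intro!: PiM_cong)
  finally show ?thesis
    by (subst P.indep_vars_iff_distr_eq_PiM'[OF assms(2)]) (auto simp: restrict_def)
qed

text \<open>The product \<open>P\<close> of \<open>m\<close> copies of \<open>N\<close> is the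
  sample space. \<open>char_power\<close> is the identity of characteristic functions which, by Levy
  uniqueness, gives the sum of the coordinates the law \<open>M\<close>.\<close>

locale iid_root = N: real_distribution N + M: real_distribution M for N M :: "real measure" +
  fixes m :: nat
  assumes m_pos: "m > 0" and char_power: "char N t ^ m = char M t"
begin

abbreviation P where "P \<equiv> PiM {..<m} (\<lambda>_. N)"

lemma prob_space_P: "prob_space P" by (intro prob_space_PiM) (rule N.prob_space_axioms)

interpretation P: prob_space P by (rule prob_space_P)

lemma measurable_coordinate [measurable]: "i < m \<Longrightarrow> (\<lambda>\<omega>. \<omega> i) \<in> borel_measurable P"
  using measurable_component_singleton[of i "{..<m}" "\<lambda>_. N"] by simp

lemma distr_coordinate: "i < m \<Longrightarrow> distr P borel (\<lambda>\<omega>. \<omega> i) = N"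
  using distr_PiM_component[of "{..<m}" "\<lambda>_. N" i] N.prob_space_axioms
    distr_cong[of P P borel N "\<lambda>\<omega>. \<omega> i" "\<lambda>\<omega>. \<omega> i"]
  by simp

lemma indep_coordinates: "P.indep_vars (\<lambda>_. borel) (\<lambda>i \<omega>. \<omega> i) {..<m}"
proof -
  have "P.indep_vars (\<lambda>_. N) (\<lambda>i \<omega>. \<omega> i) {..<m}"
    by (rule indep_vars_coordinates) (use m_pos N.prob_space_axioms in auto)
  from P.indep_vars_compose2[OF this, of "\<lambda>_ x. x"] show ?thesis by simp
qed

lemma distr_sum: "distr P borel (\<lambda>\<omega>. \<Sum>i<m. \<omega> i) = M"
proof (rule Levy_uniqueness)
  show "real_distribution (distr P borel (\<lambda>\<omega>. \<Sum>i<m. \<omega> i))"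
    by (intro P.real_distribution_distr) simp
  show "char (distr P borel (\<lambda>\<omega>. \<Sum>i<m. \<omega> i)) = char M"
    by (simp add: fun_eq_iff P.char_distr_sum[OF indep_coordinates] distr_coordinate char_power)
qed (rule M.real_distribution_axioms)

text \<open>If one copy violated the bound with probability p > 0, all \<open>m\<close> would do so
  together with probability p^m > 0, and the sum would violate the bound for \<open>M\<close>. The
  factor \<open>c\<close> covers upper and lower bounds at once.\<close>

lemma AE_root_le:
  assumes "AE x in M. c * x \<le> A"
  shows "AE y in N. c * y \<le> A / m"
proof -
  define U where "U = {y. c * y > A / m}"
  have [measurable]: "U \<in> sets borel" unfolding U_def by measurable
  have AE: "AE \<omega> in P. c * (\<Sum>i<m. \<omega> i) \<le> A"
  proof (rule AE_distrD[where P = "\<lambda>x. c * x \<le> A"])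
    show "(\<lambda>\<omega>. \<Sum>i<m. \<omega> i) \<in> measurable P borel" by simp
    show "AE x in distr P borel (\<lambda>\<omega>. \<Sum>i<m. \<omega> i). c * x \<le> A"
      unfolding distr_sum by (rule assms)
  qed
  have "AE \<omega> in P. \<omega> \<notin> PiE {..<m} (\<lambda>_. U)"
    using AE
  proof eventually_elim
    case (elim \<omega>)
    have "A < c * (\<Sum>i<m. \<omega> i)" if \<omega>: "\<omega> \<in> PiE {..<m} (\<lambda>_. U)"
    proof -
      have "(\<Sum>i<m. A / m) < (\<Sum>i<m. c * \<omega> i)"
        using m_pos \<omega> by (intro sum_strict_mono) (auto simp: U_def)
      then show ?thesis using m_pos by (simp add: sum_distrib_left)
    qed
    with elim show ?case by (meson not_le)
  qed
  then have "emeasure P (PiE {..<m} (\<lambda>_. U)) = 0"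
    using AE_iff_null_sets[of "PiE {..<m} (\<lambda>_. U)" P] by (auto intro!: sets_PiM_I_finite)
  moreover have "emeasure P (PiE {..<m} (\<lambda>_. U)) = emeasure N U ^ m"
  proof -
    interpret product_sigma_finite "\<lambda>_. N"
      by (intro product_sigma_finite.intro) (rule N.sigma_finite_measure_axioms)
    show ?thesis by (subst emeasure_PiM) auto
  qed
  ultimately have "emeasure N U = 0" using m_pos by (simp add: power_eq_0_iff)
  then have "AE y in N. y \<notin> U" by (intro AE_not_in) auto
  then show ?thesis by eventually_elim (auto simp: U_def not_less)
qed

lemma coordinate:
  fixes h :: "real \<Rightarrow> real"
  assumes i: "i < m" and h [measurable]: "h \<in> borel_measurable borel"
  shows integrable_coordinate: "integrable P (\<lambda>\<omega>. h (\<omega> i)) \<longleftrightarrow> integrable N h"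
    and expectation_coordinate: "P.expectation (\<lambda>\<omega>. h (\<omega> i)) = N.expectation h"
  using integrable_distr_eq[OF measurable_coordinate[OF i] h] integral_distr[OF measurable_coordinate[OF i] h]
  unfolding distr_coordinate[OF i] by simp_all

lemma expectation_sum:
  fixes h :: "real \<Rightarrow> real"
  assumes h: "h \<in> borel_measurable borel"
  shows "M.expectation h = P.expectation (\<lambda>\<omega>. h (\<Sum>i<m. \<omega> i))"
proof -
  have "(\<lambda>\<omega>. \<Sum>i<m. \<omega> i) \<in> borel_measurable P" by simp
  from integral_distr[OF this h] show ?thesis unfolding distr_sum .
qed

lemma expectation_root:
  assumes "integrable N (\<lambda>x. x)"
  shows "M.expectation (\<lambda>x. x) = m * N.expectation (\<lambda>x. x)"
proof -
  have "M.expectation (\<lambda>x. x) = P.expectation (\<lambda>\<omega>. \<Sum>i<m. \<omega> i)"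
    by (rule expectation_sum[of "\<lambda>x. x"]) simp
  also have "\<dots> = (\<Sum>i<m. P.expectation (\<lambda>\<omega>. \<omega> i))"
  proof (rule Bochner_Integration.integral_sum)
    fix i assume "i \<in> {..<m}"
    then show "integrable P (\<lambda>\<omega>. \<omega> i)"
      by (intro integrable_coordinate[of i "\<lambda>x. x", THEN iffD2] assms) auto
  qed
  also have "\<dots> = (\<Sum>i<m. N.expectation (\<lambda>x. x))"
    using expectation_coordinate[of _ "\<lambda>x. x"] by (intro sum.cong refl) simp
  also have "\<dots> = m * N.expectation (\<lambda>x. x)" by simp
  finally show ?thesis .
qed

text \<open>After expanding the square, independence and the zero mean kill the cross terms, leaving
  \<open>m\<close> diagonal ones.\<close>

lemma second_moment_root:
  assumes int: "integrable N (\<lambda>x. x)" "integrable N (\<lambda>x. x\<^sup>2)" and zero: "N.expectation (\<lambda>x. x) = 0"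
  shows "M.expectation (\<lambda>x. x\<^sup>2) = m * N.expectation (\<lambda>x. x\<^sup>2)"
proof -
  have int_coord: "integrable P (\<lambda>\<omega>. \<omega> i)" "integrable P (\<lambda>\<omega>. (\<omega> i)\<^sup>2)" if "i < m" for i
    by (intro integrable_coordinate[OF that, THEN iffD2, of "\<lambda>x. x"] int(1), measurable)
      (intro integrable_coordinate[OF that, THEN iffD2, of "\<lambda>x. x\<^sup>2"] int(2), measurable)
  have *: "integrable P (\<lambda>\<omega>. \<omega> i * \<omega> j) \<and>
      P.expectation (\<lambda>\<omega>. \<omega> i * \<omega> j) = (if i = j then N.expectation (\<lambda>x. x\<^sup>2) else 0)"
    if ij: "i < m" "j < m" for i j
  proof (cases "i = j")
    case True
    then show ?thesis using int_coord(2)[OF ij(1)] expectation_coordinate[OF ij(1), of "\<lambda>x. x\<^sup>2"]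
      by (simp add: power2_eq_square)
  next
    case False
    have indep: "P.indep_vars (\<lambda>_. borel) (\<lambda>i \<omega>. \<omega> i) {i, j}"
      by (rule P.indep_vars_subset[OF indep_coordinates]) (use ij in auto)
    have int: "\<And>k. k \<in> {i, j} \<Longrightarrow> integrable P (\<lambda>\<omega>. \<omega> k)" using int_coord(1) ij by auto
    show ?thesis
      using P.indep_vars_lebesgue_integral[OF _ indep int] P.indep_vars_integrable[OF _ indep int]
        False expectation_coordinate[OF ij(1), of "\<lambda>x. x"] zero by simp
  qed
  have "M.expectation (\<lambda>x. x\<^sup>2) = P.expectation (\<lambda>\<omega>. (\<Sum>i<m. \<omega> i)\<^sup>2)"
    by (rule expectation_sum[of "\<lambda>x. x\<^sup>2"]) simp
  also have "\<dots> = P.expectation (\<lambda>\<omega>. \<Sum>i<m. \<Sum>j<m. \<omega> i * \<omega> j)"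
    by (simp add: power2_eq_square sum_product)
  also have "\<dots> = (\<Sum>i<m. P.expectation (\<lambda>\<omega>. \<Sum>j<m. \<omega> i * \<omega> j))"
    by (intro Bochner_Integration.integral_sum Bochner_Integration.integrable_sum) (use * in auto)
  also have "\<dots> = (\<Sum>i<m. \<Sum>j<m. P.expectation (\<lambda>\<omega>. \<omega> i * \<omega> j))"
    by (intro sum.cong refl Bochner_Integration.integral_sum) (use * in auto)
  also have "\<dots> = (\<Sum>i<m. \<Sum>j<m. if i = j then N.expectation (\<lambda>x. x\<^sup>2) else 0)"
    by (intro sum.cong refl) (use * in auto)
  also have "\<dots> = m * N.expectation (\<lambda>x. x\<^sup>2)" by simp
  finally show ?thesis .
qed

end

theorem theorem1p3:
  fixes m :: nat and A \<sigma> :: real and M :: "real measure" and f :: "real \<Rightarrow> complex"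
  assumes "m > 0" and "A > 0"
    and "real_distribution M"
    and "f = char M"
    and "\<not> degenerate_distribution M"
    and "divisible_char_fun m f"
    and "symmetric_distribution M"
    and "compact (measure_support M)" and "measure_support M \<subseteq> {-A..A}"
    and "\<sigma> = std_dev M"
  shows "\<forall>t::real. \<bar>t\<bar> \<le> min (4.49 * real m / A) (pi * sqrt (real m) / (2 * \<sigma>)) \<longrightarrow>
           f t \<in> \<real> \<and> cos (\<sigma> * t / sqrt (real m)) ^ m \<le> Re (f t)"
proof -
  interpret M: real_distribution M by (rule assms(3))
  obtain N where N: "real_distribution N" "\<And>t. char N t ^ m = char M t"
    using assms(4,6) by (auto simp: divisible_char_fun_def is_char_fun_def)
  interpret N: real_distribution N by (rule N(1))
  interpret iid_root N M m by unfold_locales (use assms(1) N(2) in auto)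
  define T where "T = min (4.49 * real m / A) (pi * sqrt (real m) / (2 * \<sigma>))"
  define s where "s = (\<lambda>t. \<sigma> * t / sqrt (real m))"

  have bdM: "AE x in M. \<bar>x\<bar> \<le> A"
    using M.AE_in_measure_support by eventually_elim (use assms(9) in \<open>auto simp: abs_le_iff\<close>)
  have "AE x in M. 1 * x \<le> A" "AE x in M. (-1) * x \<le> A"
    using bdM by (auto elim!: eventually_mono)
  from this[THEN AE_root_le] have bdN: "AE y in N. \<bar>y\<bar> \<le> A / m"
    by eventually_elim auto
  have int: "integrable N (\<lambda>x. x)" "integrable N (\<lambda>x. x\<^sup>2)"
    using N.integrable_power_bounded[OF bdN, of 1] N.integrable_power_bounded[OF bdN, of 2]
    by (simp_all only: power_one_right)
  have mean: "M.expectation (\<lambda>x. x) = 0" by (rule M.expectation_symmetric) fact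
  then have "N.expectation (\<lambda>x. x) = 0" using expectation_root[OF int(1)] assms(1) by simp
  from second_moment_root[OF int this]
  have var: "\<sigma>\<^sup>2 = m * N.expectation (\<lambda>x. x\<^sup>2)"
    using assms(10) by (simp add: std_dev_def mean integral_nonneg_AE)
  have \<sigma>: "0 \<le> \<sigma>" using assms(10) by (simp add: std_dev_def)

  \<comment> \<open>For \<open>\<sigma> = 0\<close> the quotient by \<open>2 * \<sigma>\<close> is 0
    by convention, so the range of \<open>t\<close> shrinks to a point.\<close>
  have zero: "t = 0" if "\<sigma> = 0" "\<bar>t\<bar> \<le> T" for t using that by (simp add: T_def)
  have s_bound: "\<bar>s t\<bar> \<le> pi / 2" if "\<bar>t\<bar> \<le> T" for t
    using that \<sigma> assms(1) zero[of t]
    by (cases "\<sigma> = 0") (auto simp: T_def s_def abs_mult field_simps)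
  have s_bound_strict: "\<bar>s t\<bar> < pi / 2" if "\<bar>t\<bar> < T" for t
    using that \<sigma> assms(1) zero[of t]
    by (cases "\<sigma> = 0") (auto simp: T_def s_def abs_mult field_simps)

  have Re_ge: "cos (s t) \<le> Re (char N t)" if t: "\<bar>t\<bar> \<le> T" for t
  \<comment> \<open>The Jensen bound \<open>cos_le_Re_char\<close> asks for a nonzero angle; a zero
    angle forces \<open>t = 0\<close>, where both sides are 1.\<close>
  proof (cases "s t = 0")
    case True
    then have "t = 0" using zero[OF _ t] assms(1) by (auto simp: s_def)
    then show ?thesis by (simp add: s_def N.char_zero)
  next
    case False
    show ?thesis
    proof (rule N.cos_le_Re_char[OF bdN])
      show "\<bar>t\<bar> * (A / m) \<le> 4.49"
        using t assms(1,2) by (simp add: T_def field_simps)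
      show "(s t)\<^sup>2 = t\<^sup>2 * N.expectation (\<lambda>x. x\<^sup>2)"
        using var assms(1) by (simp add: s_def power_divide power_mult_distrib)
      show "\<bar>s t\<bar> \<le> 4.49" using s_bound[OF t] pi_approx by simp
    qed fact
  qed

  \<comment> \<open>At \<open>\<bar>t\<bar> = T\<close> the cosine may vanish, so the connectedness
    argument is confined to the open interval.\<close>
  have interior: "char N t \<in> \<real>" if t: "t \<in> {-T<..<T}" for t
  proof (rule real_if_power_real_connected[where S = "{-T<..<T}" and a = 0])
    show "continuous_on {-T<..<T} (char N)"
      by (intro continuous_at_imp_continuous_on ballI N.isCont_char)
    fix u assume "u \<in> {-T<..<T}"
    then have u: "\<bar>u\<bar> < T" by auto
    then have "0 < cos (s u)" using s_bound_strict[OF u] by (intro cos_gt_zero_pi) auto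
    then show "char N u \<noteq> 0" using Re_ge[of u] u by auto
    show "char N u ^ m \<in> \<real>"
      using M.Im_char_symmetric[OF assms(7)] by (simp add: char_power complex_is_Real_iff)
  qed (use t assms(1) N.char_zero in auto)
  have real: "char N t \<in> \<real>" if t: "\<bar>t\<bar> \<le> T" for t
  \<comment> \<open>For \<open>T = 0\<close> the open interval is empty and its closure misses the
    point 0. Otherwise the closed condition \<open>Im = 0\<close> passes to the endpoints.\<close>
  proof (cases "T = 0")
    case True
    with t show ?thesis by (simp add: N.char_zero)
  next
    case False
    have "closed {t. Im (char N t) = 0}"
      by (intro closed_Collect_eq continuous_intros continuous_at_imp_continuous_on ballI N.isCont_char)
    then have "closure {-T<..<T} \<subseteq> {t. Im (char N t) = 0}"
      using interior by (intro closure_minimal) (auto simp: complex_is_Real_iff)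
    moreover have "closure {-T<..<T} = {-T..T}"
      using t False by (intro closure_greaterThanLessThan) auto
    moreover have "t \<in> {-T..T}" using t by auto
    ultimately show ?thesis by (auto simp: complex_is_Real_iff subset_eq)
  qed

  have "f t \<in> \<real> \<and> cos (s t) ^ m \<le> Re (f t)" if t: "\<bar>t\<bar> \<le> T" for t
  proof -
    have "char N t = of_real (Re (char N t))" using real[OF t] by simp
    then have f: "f t = of_real (Re (char N t) ^ m)"
      using char_power[of t] assms(4) by (metis of_real_power)
    have "0 \<le> cos (s t)" using s_bound[OF t] by (intro cos_ge_zero) auto
    then have "cos (s t) ^ m \<le> Re (char N t) ^ m" by (intro power_mono Re_ge t)
    with f show ?thesis by simp
  qed
  then show ?thesis by (simp add: T_def s_def)
qed

end
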